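(* Let $f : \mathbb{N} \to \mathbb{R}$ be such that $\sum_{n \ge 1} |\Delta^2 f(n)| < \infty$. Then: 1. $\Delta f(n) \to \psi$ as $n \to \infty$ for some $\psi \in \mathbb{R}$. 2. If $\psi \notin \mathbb{Z}$, then the sequence of exponential sums $\left\{\sum_{n=1}^{N} e(f(n)) : N \ge 1\right\}$ is bounded.
   Context: $\mathbb{N} = \{1,2,3,\ldots\}$. For real $x$, $e(x) := e^{2\pi i x}$. For $f : \mathbb{N} \to \mathbb{R}$, $\Delta f(n) := f(n+1) - f(n)$ and $\Delta^2 f(n) := \Delta f(n+1) - \Delta f(n) = f(n+2) - 2f(n+1) + f(n)$. *)

theory Defs
  imports "HOL-Analysis.Analysis"
begin

text \<open>
  Sequences indexed by the positive integers are represented by functions on \<^typ>\<open>nat\<close> of which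
  only the values at arguments \<open>n \<ge> 1\<close> are used; the value at 0 is irrelevant.
\<close>

definition e :: "real \<Rightarrow> complex" where
  "e x = exp (2 * complex_of_real pi * \<i> * complex_of_real x)"

definition fdiff :: "(nat \<Rightarrow> real) \<Rightarrow> nat \<Rightarrow> real" where
  "fdiff f n = f (n + 1) - f n"

definition fdiff2 :: "(nat \<Rightarrow> real) \<Rightarrow> nat \<Rightarrow> real" where
  "fdiff2 f n = fdiff f (n + 1) - fdiff f n"

end

theory Submission
  imports Defs
begin

text \<open>
  With \<open>z n = e (f n)\<close>, \<open>w n = e (fdiff f n)\<close> and \<open>c n = 1 / (w n - 1)\<close> one has
  \<open>z (n + 1) = w n * z n\<close>, hence \<open>z n = c n * (z (n + 1) - z n)\<close>. Summation by parts shows that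
  the partial sums of \<open>z\<close>, corrected by the bounded term \<open>c (N + 1) * z (N + 1)\<close>, have increments
  \<open>(c (N + 1) - c (N + 2)) * z (N + 2)\<close>. Since \<open>w n\<close> tends to \<open>e \<psi> \<noteq> 1\<close>, these are eventually
  dominated by a multiple of \<open>\<bar>fdiff2 f (N + 1)\<bar>\<close>, so the corrected partial sums converge.
\<close>

lemma e_add: "e (x + y) = e x * e y"
  by (simp add: e_def distrib_left exp_add)

lemma norm_e [simp]: "norm (e x) = 1"
  by (simp add: e_def)

lemma e_eq_1_iff: "e x = 1 \<longleftrightarrow> x \<in> \<int>"
proof -
  have "e x = 1 \<longleftrightarrow> (\<exists>n::int. 2 * pi * x = of_int (2 * n) * pi)"
    by (simp add: e_def exp_eq_1)
  also have "\<dots> \<longleftrightarrow> x \<in> \<int>"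
    by (auto simp: Ints_def)
  finally show ?thesis .
qed

lemma isCont_e [continuous_intros]: "isCont e x"
  unfolding e_def by (intro continuous_intros)

text \<open>Factoring out the unimodular \<open>e y\<close> leaves the chord from 1 to
  \<open>e (x - y)\<close>, of length 2 |sin (pi (x - y))|; then |sin t| \<le> |t|.\<close>

lemma norm_e_diff_le: "norm (e x - e y) \<le> 2 * pi * \<bar>x - y\<bar>"
proof -
  have "e x - e y = e y * (e (x - y) - 1)"
    using e_add[of y "x - y"] by (simp add: algebra_simps)
  then have "norm (e x - e y) = norm (exp (\<i> * complex_of_real (2 * pi * (x - y))) - 1)"
    by (simp add: norm_mult e_def mult_ac)
  also have "\<dots> = 2 * \<bar>sin (2 * pi * (x - y) / 2)\<bar>"
    by (rule dist_exp_i_1)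
  also have "\<dots> \<le> 2 * \<bar>2 * pi * (x - y) / 2\<bar>"
    using abs_sin_x_le_abs_x by (intro mult_left_mono) auto
  finally show ?thesis
    by (simp add: abs_mult)
qed

lemma convergent_if_summable_increments:
  fixes T :: "nat \<Rightarrow> 'a::real_normed_vector"
  assumes "summable (\<lambda>n. T (Suc n) - T n)"
  shows "convergent T"
proof -
  have "convergent (\<lambda>n. T n - T 0)"
    using assms by (simp add: summable_iff_convergent sum_lessThan_telescope)
  then show ?thesis
    by (simp add: convergent_diff_const_right_iff)
qed

lemma norm_inverse_diff_le:
  fixes u v :: "'a::real_normed_field"
  assumes "d > 0" "norm u \<ge> d" "norm v \<ge> d"
  shows "norm (inverse u - inverse v) \<le> norm (u - v) / d\<^sup>2"
proof -
  have "u \<noteq> 0" "v \<noteq> 0"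
    using assms by auto
  then have "norm (inverse u - inverse v) = norm (u - v) / (norm u * norm v)"
    by (simp add: inverse_diff_inverse norm_mult norm_inverse divide_inverse mult_ac)
  also have "\<dots> \<le> norm (u - v) / d\<^sup>2"
    using assms by (intro divide_left_mono) (auto simp: power2_eq_square intro!: mult_mono mult_pos_pos)
  finally show ?thesis .
qed

lemma exp_sums_bounded:
  fixes f :: "nat \<Rightarrow> real"
  assumes summ: "summable (\<lambda>n. \<bar>fdiff2 f (Suc n)\<bar>)"
    and lim: "fdiff f \<longlonglongrightarrow> \<psi>" and nonint: "\<psi> \<notin> \<int>"
  shows "Bseq (\<lambda>N. \<Sum>n = 1..N. e (f n))"
proof -
  define v where "v n = e (fdiff f n) - 1" for n
  define c where "c n = inverse (v n)" for n
  define T where "T N = (\<Sum>n = 1..N. e (f n)) - c (Suc N) * e (f (Suc N))" for N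
  \<comment> \<open>Half the norm of the nonzero limit of \<open>v\<close>: a positive lower bound
    that \<open>norm (v n)\<close> eventually exceeds.\<close>
  define d where "d = norm (e \<psi> - 1) / 2"
  have "e \<psi> \<noteq> 1"
    using nonint by (simp add: e_eq_1_iff)
  then have "d > 0" "d < norm (e \<psi> - 1)"
    by (auto simp: d_def)
  have v_lim: "v \<longlonglongrightarrow> e \<psi> - 1"
    unfolding v_def by (intro tendsto_intros isCont_tendsto_compose[OF isCont_e] lim)
  have v_ge: "\<forall>\<^sub>F n in sequentially. norm (v n) > d"
    using order_tendstoD(1)[OF tendsto_norm[OF v_lim] \<open>d < _\<close>] .
  \<comment> \<open>The increment of \<open>T\<close> at \<open>n\<close> involves \<open>c\<close>
    at both \<open>n + 1\<close> and \<open>n + 2\<close>.\<close>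
  have v_ge1: "\<forall>\<^sub>F n in sequentially. norm (v (Suc n)) > d"
    and v_ge2: "\<forall>\<^sub>F n in sequentially. norm (v (Suc (Suc n))) > d"
    using v_ge eventually_sequentially_Suc[of "\<lambda>n. norm (v n) > d"]
      eventually_sequentially_Suc[of "\<lambda>n. norm (v (Suc n)) > d"] by auto
  have "\<forall>\<^sub>F n in sequentially. norm (T (Suc n) - T n) \<le> 2 * pi / d\<^sup>2 * \<bar>fdiff2 f (Suc n)\<bar>"
    using v_ge1 v_ge2
  proof eventually_elim
    case (elim n)
    define a where "a = Suc n"
    have "v a \<noteq> 0"
      using elim \<open>d > 0\<close> by (auto simp: a_def)
    \<comment> \<open>This is \<open>c a * v a = 1\<close> rearranged; it would fail for
      \<open>v a = 0\<close>, where \<open>inverse\<close> returns 0.\<close>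
    then have c1: "1 + c a = c a * e (fdiff f a)"
      by (simp add: c_def v_def field_simps)
    have z: "e (f (Suc a)) = e (fdiff f a) * e (f a)"
      by (simp add: fdiff_def flip: e_add)
    \<comment> \<open>The new summand \<open>e (f a)\<close> merges with the old correction term
      \<open>c a * e (f a)\<close>.\<close>
    have "T (Suc n) - T n = (1 + c a) * e (f a) - c (Suc a) * e (f (Suc a))"
      by (simp add: T_def a_def algebra_simps)
    also have "\<dots> = (c a - c (Suc a)) * e (f (Suc a))"
      unfolding c1 z by (simp add: algebra_simps)
    finally have "norm (T (Suc n) - T n) = norm (c a - c (Suc a))"
      by (simp add: norm_mult)
    also have "\<dots> \<le> norm (v a - v (Suc a)) / d\<^sup>2"
      unfolding c_def using elim \<open>d > 0\<close> by (intro norm_inverse_diff_le) (auto simp: a_def)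
    also have "norm (v a - v (Suc a)) \<le> 2 * pi * \<bar>fdiff2 f a\<bar>"
      using norm_e_diff_le[of "fdiff f a" "fdiff f (Suc a)"]
      by (simp add: v_def fdiff2_def abs_minus_commute)
    finally show ?case
      by (simp add: a_def divide_right_mono)
  qed
  then have "summable (\<lambda>n. T (Suc n) - T n)"
    by (rule summable_comparison_test_ev) (intro summable_mult summ)
  then have T_bdd: "Bseq T"
    by (intro convergent_imp_Bseq convergent_if_summable_increments)
  \<comment> \<open>Convergence bounds \<open>c\<close> at every index, including the finitely many
    where \<open>v n\<close> may vanish.\<close>
  have "c \<longlonglongrightarrow> inverse (e \<psi> - 1)"
    unfolding c_def using \<open>e \<psi> \<noteq> 1\<close> by (intro tendsto_inverse v_lim) auto
  then have "Bseq c"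
    by (intro convergent_imp_Bseq convergentI)
  then have "Bseq (\<lambda>N. c (Suc N) * e (f (Suc N)))"
    by (subst Bseq_Suc_iff) (auto simp: Bseq_def norm_mult)
  with T_bdd have "bounded (range (\<lambda>N. T N + c (Suc N) * e (f (Suc N))))"
    unfolding Bseq_eq_bounded by (rule bounded_plus_comp)
  then show ?thesis
    by (simp add: T_def Bseq_eq_bounded)
qed

theorem theorem2p5:
  fixes f :: "nat \<Rightarrow> real"
  assumes "(\<lambda>n. \<bar>fdiff2 f n\<bar>) summable_on {1..}"
  shows "\<exists>\<psi>::real. (fdiff f \<longlonglongrightarrow> \<psi>) \<and>
           (\<psi> \<notin> \<int> \<longrightarrow> bounded {\<Sum>n = 1..N. e (f n) | N::nat. N \<ge> 1})"
proof -
  \<comment> \<open>Reindexing along \<open>Suc\<close> moves the sum to all naturals, where for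
    nonnegative terms unconditional and ordinary summability agree.\<close>
  have "{1..} = range Suc"
    by (auto simp: image_iff Suc_le_eq gr0_conv_Suc)
  with assms have "(\<lambda>n. \<bar>fdiff2 f n\<bar>) summable_on range Suc"
    by simp
  then have "(\<lambda>n. \<bar>fdiff2 f (Suc n)\<bar>) summable_on UNIV"
    by (subst (asm) summable_on_reindex) (auto simp: o_def)
  then have summ: "summable (\<lambda>n. \<bar>fdiff2 f (Suc n)\<bar>)"
    by (simp add: summable_on_UNIV_nonneg_real_iff)
  \<comment> \<open>The increments of the shifted first differences are the second differences,
    whose series converges absolutely.\<close>
  have "convergent (\<lambda>n. fdiff f (Suc n))"
    using summable_rabs_cancel[OF summ]
    by (intro convergent_if_summable_increments) (simp add: fdiff2_def)
  then obtain \<psi> where \<psi>: "fdiff f \<longlonglongrightarrow> \<psi>"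
    by (auto simp: convergent_def filterlim_sequentially_Suc)
  \<comment> \<open>The \<open>Bseq\<close> bound also covers the empty sum at \<open>N = 0\<close>,
    so only a subset is needed.\<close>
  have "bounded {\<Sum>n = 1..N. e (f n) | N::nat. N \<ge> 1}" if "\<psi> \<notin> \<int>"
    using exp_sums_bounded[OF summ \<psi> that] unfolding Bseq_eq_bounded
    by (rule bounded_subset) auto
  with \<psi> show ?thesis
    by blast
qed

end
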